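(* Let $\mathcal{A}$ be a unital $C^*$-algebra over $\mathbb{F}$, where $\mathbb{F}=\mathbb{R}$ or $\mathbb{C}$, and let $\mathcal{E}$ be a Hilbert $C^*$-module over $\mathcal{A}$. Let $e\in\mathcal{E}$ and let $\mathcal{B}$ be a subspace of $\mathcal{E}$. Then $e$ is Birkhoff-James orthogonal to $\mathcal{B}$ in the Banach space $\mathcal{E}$ if and only if there exists a state $\phi$ on $\mathcal{A}$ such that $\phi(\langle e,e\rangle)=\|e\|^2$ and $\phi(\langle e,b\rangle)=0$ for all $b\in\mathcal{B}$.
   Context: A Hilbert $C^*$-module $\mathcal{E}$ over $\mathcal{A}$ is a right $\mathcal{A}$-module (and $\mathbb{F}$-vector space, with compatible scalar actions) with a function $\langle\cdot,\cdot\rangle:\mathcal{E}\times\mathcal{E}\to\mathcal{A}$ such that for all $\xi,\eta,\zeta\in\mathcal{E}$, $c\in\mathcal{A}$, $\lambda\in\mathbb{F}$: (1) $\langle\xi,\eta+\zeta\rangle=\langle\xi,\eta\rangle+\langle\xi,\zeta\rangle$ and $\langle\xi,\lambda\eta\rangle=\lambda\langle\xi,\eta\rangle$; (2) $\langle\xi,\eta c\rangle=\langle\xi,\eta\rangle c$; (3) $\langle\xi,\eta\rangle=\langle\eta,\xi\rangle^*$; (4) $\langle\xi,\xi\rangle$ is a positive element of $\mathcal{A}$; moreover $\langle\xi,\xi\rangle=0$ only if $\xi=0$, and $\mathcal{E}$ is complete in the norm $\|\xi\|=\|\langle\xi,\xi\rangle\|^{1/2}$. "Subspace" means $\mathbb{F}$-linear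 subspace (not assumed closed). The element $e$ is Birkhoff-James orthogonal to $\mathcal{B}$ if $\|e\|\le\|e+b\|$ for all $b\in\mathcal{B}$. For $\mathbb{F}=\mathbb{C}$, a state on $\mathcal{A}$ is a positive linear functional $\phi$ on $\mathcal{A}$ (i.e. mapping positive elements to nonnegative reals) with $\phi(1_{\mathcal{A}})=1$, where $1_{\mathcal{A}}$ is the identity of $\mathcal{A}$; for $\mathbb{F}=\mathbb{R}$, it is additionally required that $\phi(c^* )=\phi(c)$ for all $c\in\mathcal{A}$. *)

theory Defs
  imports "HOL-Analysis.Analysis"
begin

section \<open>The scalar field\<close>

text \<open>
  One class for the scalars, so that the real and the complex theory are stated together.
  Its instances are exactly the reals and the complex numbers with their usual absolute value and
  conjugation: see the two instance proofs and \<open>real_or_complex_cases\<close> below. The real case is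
  recognised by \<open>\<real> = UNIV\<close>.
\<close>

class real_or_complex = real_normed_field +
  fixes fcnj :: "'a \<Rightarrow> 'a"
  assumes fcnj_add: "fcnj (x + y) = fcnj x + fcnj y"
    and fcnj_mult_self_scaleR: "fcnj x * x = (norm x)\<^sup>2 *\<^sub>R 1"

instantiation real :: real_or_complex
begin
definition fcnj_real :: "real \<Rightarrow> real" where "fcnj_real x = x"
instance by standard (simp_all add: fcnj_real_def power2_eq_square)
end

instantiation complex :: real_or_complex
begin
definition fcnj_complex :: "complex \<Rightarrow> complex" where "fcnj_complex = cnj"
instance
  by standard (simp_all add: fcnj_complex_def complex_norm_square[symmetric] scaleR_conv_of_real
      mult.commute)
end

lemma fcnj_mult_self: "fcnj x * x = of_real ((norm (x :: 'f::real_or_complex))\<^sup>2)"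
  by (simp only: fcnj_mult_self_scaleR of_real_def)

lemma fcnj_of_real: "fcnj (of_real r) = (of_real r :: 'f::real_or_complex)"
proof (cases "r = 0")
  case True
  then show ?thesis using fcnj_add[of "0::'f" 0] by simp
next
  case False
  then show ?thesis using fcnj_mult_self[of "of_real r :: 'f"] by (simp add: power2_eq_square)
qed

lemma fcnj_minus: "fcnj (- x) = - fcnj (x :: 'f::real_or_complex)"
  using fcnj_add[of x "- x"] fcnj_of_real[of 0, where 'f='f] by (simp add: eq_neg_iff_add_eq_0 add.commute)

lemma fcnj_mult: "fcnj (x * y) = fcnj x * fcnj (y :: 'f::real_or_complex)"
proof (cases "x * y = 0")
  case True
  then show ?thesis using fcnj_of_real[of 0, where 'f='f] by auto
next
  case False
  have "fcnj (x * y) * (x * y) = (fcnj x * x) * (fcnj y * y)"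
    by (simp only: fcnj_mult_self norm_mult power_mult_distrib of_real_mult)
  also have "\<dots> = (fcnj x * fcnj y) * (x * y)"
    by (simp add: algebra_simps)
  finally show ?thesis using False by simp
qed

lemma add_fcnj_real: "x + fcnj (x :: 'f::real_or_complex) \<in> \<real>"
proof -
  have "of_real ((norm (1 + x))\<^sup>2) = fcnj (1 + x) * (1 + x)" by (simp only: fcnj_mult_self)
  also have "\<dots> = 1 + (x + fcnj x) + of_real ((norm x)\<^sup>2)"
    using fcnj_of_real[of 1, where 'f='f]
    by (simp only: fcnj_mult_self[symmetric] fcnj_add) (simp add: algebra_simps)
  finally have "x + fcnj x = of_real ((norm (1 + x))\<^sup>2 - 1 - (norm x)\<^sup>2)"
    by (simp add: algebra_simps)
  then show ?thesis by (metis Reals_of_real)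
qed

lemma real_imag_decomp:
  fixes z :: "'f::real_or_complex"
  obtains x w where "z = of_real x + w" "fcnj w = - w"
proof -
  obtain r where r: "z + fcnj z = of_real r" using add_fcnj_real Reals_cases by blast
  have c: "fcnj z = of_real r - z" using r by (simp add: algebra_simps)
  have h: "of_real r = of_real (r / 2) + (of_real (r / 2) :: 'f)"
    by (simp only: of_real_add[symmetric] field_sum_of_halves)
  have "fcnj (z + of_real (- r / 2)) = - (z + of_real (- r / 2))"
    unfolding fcnj_add fcnj_of_real c h by simp
  then show ?thesis by (intro that[of "r / 2" "z + of_real (- r / 2)"]) auto
qed

theorem real_or_complex_cases:
  fixes dummy :: "'f::real_or_complex"
  shows "(\<real> :: 'f set) = UNIV \<or>
    (\<exists>h :: complex \<Rightarrow> 'f. bij h \<and> (\<forall>x y. h (x + y) = h x + h y) \<and> (\<forall>x y. h (x * y) = h x * h y) \<and>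
       (\<forall>r. h (of_real r) = of_real r) \<and> (\<forall>x. norm (h x) = norm x) \<and> (\<forall>x. h (cnj x) = fcnj (h x)))"
proof (cases "(\<real> :: 'f set) = UNIV")
  case False
  then obtain z :: 'f where z: "z \<notin> \<real>" by blast
  obtain x w where xw: "z = of_real x + w" "fcnj w = - w" by (rule real_imag_decomp)
  have w0: "w \<noteq> 0" using z xw(1) by auto
  define i where "i = of_real (1 / norm w) * w"
  have ci: "fcnj i = - i" by (simp add: i_def fcnj_mult fcnj_of_real xw(2) del: of_real_divide)
  have ni: "norm i = 1" using w0 by (simp add: i_def norm_mult norm_divide)
  have ii: "i * i = - 1" using fcnj_mult_self[of i] ci ni by (simp add: equation_minus_iff)
  have iinv: "i * (i * a) = - a" for a using ii by (simp add: mult.assoc[symmetric])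
  define h :: "complex \<Rightarrow> 'f" where "h c = of_real (Re c) + of_real (Im c) * i" for c
  have add: "h (a + b) = h a + h b" for a b by (simp add: h_def algebra_simps)
  have mult: "h (a * b) = h a * h b" for a b
    by (simp add: h_def algebra_simps iinv ii)
  have re: "h (of_real r) = of_real r" for r by (simp add: h_def)
  have cn: "h (cnj a) = fcnj (h a)" for a
    by (simp add: h_def fcnj_add fcnj_mult fcnj_of_real ci)
  have nm: "norm (h a) = norm a" for a
  proof -
    have "of_real ((norm (h a))\<^sup>2) = h (cnj a * a)" by (simp only: mult cn fcnj_mult_self)
    also have "\<dots> = of_real ((norm a)\<^sup>2)"
      by (simp only: re[symmetric] complex_norm_square mult.commute)
    finally have "(norm (h a))\<^sup>2 = (norm a)\<^sup>2" by (simp only: of_real_eq_iff)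
    then show ?thesis by simp
  qed
  have "inj h"
  proof (rule injI)
    fix a b assume "h a = h b"
    then have "h (a - b) = 0" using add[of "a - b" b] by simp
    then show "a = b" using nm[of "a - b"] by simp
  qed
  moreover have "surj h"
  proof -
    have "\<exists>a. u = h a" for u
    proof -
      obtain y v where yv: "u = of_real y + v" "fcnj v = - v" by (rule real_imag_decomp)
      have "v * v = (of_real (norm v) * i) * (of_real (norm v) * i)"
        using arg_cong[OF fcnj_mult_self[of v], of uminus] yv(2)
        by (simp add: algebra_simps iinv ii power2_eq_square)
      then have "v = of_real (norm v) * i \<or> v = of_real (- norm v) * i"
        using square_eq_iff by (metis mult_minus_left of_real_minus)
      then show ?thesis
        using yv(1) by (auto simp: h_def intro: exI[of _ "Complex y (norm v)"] exI[of _ "Complex y (- norm v)"])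
    qed
    then show ?thesis by (auto simp: surj_def)
  qed
  ultimately have "bij h" by (simp add: bij_def)
  then show ?thesis using add mult re nm cn by blast
qed simp


section \<open>Unital C*-algebras\<close>

definition invertible_elem :: "'a::ring_1 \<Rightarrow> bool" where
  "invertible_elem a \<longleftrightarrow> (\<exists>b. a * b = 1 \<and> b * a = 1)"

text \<open>
  The classes give \<open>'a\<close> a submultiplicative complete norm with \<open>\<parallel>1\<parallel> = 1\<close>, hence \<open>1 \<noteq> 0\<close>, and an
  action of the real numbers, with which \<open>scaleA_of_real\<close> makes the action of the scalar field agree.
  In the real case the last axiom is the usual one for real C*-algebras, excluding for example
  the complex numbers with the identity as involution; in the complex case it is a theorem.
\<close>

locale unital_cstar_algebra = vector_space scaleA
  for scaleA :: "'f::real_or_complex \<Rightarrow> 'a::{real_normed_algebra_1, banach} \<Rightarrow> 'a" +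
  fixes star :: "'a \<Rightarrow> 'a"
  assumes scaleA_of_real: "scaleA (of_real r) a = r *\<^sub>R a"
    and norm_scaleA: "norm (scaleA l a) = norm l * norm a"
    and scaleA_mult_left: "scaleA l a * b = scaleA l (a * b)"
    and scaleA_mult_right: "a * scaleA l b = scaleA l (a * b)"
    and star_star: "star (star a) = a"
    and star_add: "star (a + b) = star a + star b"
    and star_scaleA: "star (scaleA l a) = scaleA (fcnj l) (star a)"
    and star_mult: "star (a * b) = star b * star a"
    and cstar_identity: "norm (star a * a) = (norm a)\<^sup>2"
    and real_cstar: "(\<real> :: 'f set) = UNIV \<Longrightarrow> invertible_elem (1 + star a * a)"

definition spectrum :: "('f::real_or_complex \<Rightarrow> 'a::ring_1 \<Rightarrow> 'a) \<Rightarrow> 'a \<Rightarrow> 'f set" where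
  "spectrum scaleA a = {l. \<not> invertible_elem (scaleA l 1 - a)}"

text \<open>
  For real scalars \<open>spectrum\<close> contains only the real spectral values. This is the whole spectrum
  when \<open>a\<close> is self-adjoint: for real \<open>s\<close> and \<open>t \<noteq> 0\<close> the element \<open>(a - s)\<^sup>2 + t\<^sup>2\<close> is invertible by
  \<open>real_cstar\<close>, so \<open>s + \<i>t\<close> is not in the spectrum of \<open>a\<close> in the complexification.
\<close>

definition positive_elem ::
  "('f::real_or_complex \<Rightarrow> 'a::ring_1 \<Rightarrow> 'a) \<Rightarrow> ('a \<Rightarrow> 'a) \<Rightarrow> 'a \<Rightarrow> bool" where
  "positive_elem scaleA star a \<longleftrightarrow> star a = a \<and> spectrum scaleA a \<subseteq> \<real>\<^sub>\<ge>\<^sub>0"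

definition state ::
  "('f::real_or_complex \<Rightarrow> 'a::ring_1 \<Rightarrow> 'a) \<Rightarrow> ('a \<Rightarrow> 'a) \<Rightarrow> ('a \<Rightarrow> 'f) \<Rightarrow> bool" where
  "state scaleA star \<phi> \<longleftrightarrow>
     Vector_Spaces.linear scaleA (*) \<phi> \<and>
     (\<forall>a. positive_elem scaleA star a \<longrightarrow> \<phi> a \<in> \<real>\<^sub>\<ge>\<^sub>0) \<and>
     \<phi> 1 = 1 \<and>
     ((\<real> :: 'f set) = UNIV \<longrightarrow> (\<forall>c. \<phi> (star c) = \<phi> c))"


section \<open>Hilbert C*-modules\<close>

definition module_norm :: "('e \<Rightarrow> 'e \<Rightarrow> 'a::real_normed_vector) \<Rightarrow> 'e \<Rightarrow> real" where
  "module_norm ip x = sqrt (norm (ip x x))"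

text \<open>\<open>act x c\<close> is the right action \<open>xc\<close>.\<close>

locale hilbert_cstar_module = unital_cstar_algebra scaleA star + E: vector_space scaleE
  for scaleA :: "'f::real_or_complex \<Rightarrow> 'a::{real_normed_algebra_1, banach} \<Rightarrow> 'a"
    and star :: "'a \<Rightarrow> 'a"
    and scaleE :: "'f \<Rightarrow> 'e::ab_group_add \<Rightarrow> 'e" +
  fixes act :: "'e \<Rightarrow> 'a \<Rightarrow> 'e" and ip :: "'e \<Rightarrow> 'e \<Rightarrow> 'a"
  assumes act_add_left: "act (x + y) c = act x c + act y c"
    and act_add_right: "act x (c + d) = act x c + act x d"
    and act_mult: "act x (c * d) = act (act x c) d"
    and act_one: "act x 1 = x"
    and scaleE_act: "scaleE l (act x c) = act (scaleE l x) c"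
    and act_scaleA: "act x (scaleA l c) = scaleE l (act x c)"
    and ip_add_right: "ip x (y + z) = ip x y + ip x z"
    and ip_scaleE_right: "ip x (scaleE l y) = scaleA l (ip x y)"
    and ip_act_right: "ip x (act y c) = ip x y * c"
    and ip_star: "ip x y = star (ip y x)"
    and ip_positive: "positive_elem scaleA star (ip x x)"
    and ip_definite: "ip x x = 0 \<Longrightarrow> x = 0"
    and complete: "Metric_space.mcomplete UNIV (\<lambda>x y. module_norm ip (x - y))"

definition bj_orthogonal :: "('e::plus \<Rightarrow> real) \<Rightarrow> 'e \<Rightarrow> 'e set \<Rightarrow> bool" where
  "bj_orthogonal nrm e B \<longleftrightarrow> (\<forall>b\<in>B. nrm e \<le> nrm (e + b))"

end

theory Submission
  imports Defs
begin

text \<open>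
  If \<open>\<phi>\<close> is such a state, then \<open>\<parallel>e + b\<parallel>\<^sup>2 \<ge> \<phi> \<langle>e + b, e + b\<rangle> = \<parallel>e\<parallel>\<^sup>2 + \<phi> \<langle>b, b\<rangle> \<ge> \<parallel>e\<parallel>\<^sup>2\<close>.
  Conversely, put \<open>w = 1 + \<langle>e, e\<rangle>\<close>. Since \<open>\<parallel>1 + a\<parallel> = 1 + \<parallel>a\<parallel>\<close> for positive \<open>a\<close>, orthogonality says to
  first order that \<open>\<parallel>w + h\<parallel> \<ge> 1 + \<parallel>e\<parallel>\<^sup>2\<close> for all \<open>h\<close> in the real subspace of the elements
  \<open>\<langle>e, b\<rangle> + \<langle>b, e\<rangle>\<close>. By Hahn-Banach a real functional \<open>f \<le> \<parallel>\<cdot>\<parallel>\<close> vanishes on that subspace and has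
  \<open>f w \<ge> 1 + \<parallel>e\<parallel>\<^sup>2\<close>, which forces both \<open>f 1 = 1\<close> and \<open>f \<langle>e, e\<rangle> = \<parallel>e\<parallel>\<^sup>2\<close>. It is nonnegative on positive
  elements because \<open>\<parallel>\<parallel>a\<parallel> - a\<parallel> \<le> \<parallel>a\<parallel>\<close> for them, and its symmetrisation is the real part of a state.

  The facts on positive elements rest on \<open>\<parallel>a\<parallel>\<close> or \<open>- \<parallel>a\<parallel>\<close> being in the spectrum of a self-adjoint
  \<open>a\<close>. This is proved for real and complex scalars at once, without complexification and without
  the spectral radius formula, by means of the Poisson kernel.
\<close>

section \<open>The Hahn-Banach theorem\<close>

definition sublinear :: "('v::real_vector \<Rightarrow> real) \<Rightarrow> bool" where
  "sublinear p \<longleftrightarrow> (\<forall>x y. p (x + y) \<le> p x + p y) \<and> (\<forall>r\<ge>0. \<forall>x. p (r *\<^sub>R x) = r * p x)"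

lemma sublinear_add: "sublinear p \<Longrightarrow> p (x + y) \<le> p x + p y"
  by (simp add: sublinear_def)

lemma sublinear_scale: "sublinear p \<Longrightarrow> 0 \<le> r \<Longrightarrow> p (r *\<^sub>R x) = r * p x"
  by (simp add: sublinear_def)

lemma sublinear_zero: "sublinear p \<Longrightarrow> p 0 = 0"
  using sublinear_scale[of p 0 0] by simp

lemma sublinear_neg: "sublinear p \<Longrightarrow> - p (- x) \<le> p x"
  using sublinear_add[of p x "- x"] sublinear_zero[of p] by simp

text \<open>An infimum of sublinear maps yields homogeneity directly only as \<open><=\<close>. The
  same inequality for \<open>1 / r\<close> at the point \<open>r *\<^sub>R x\<close> gives the
  reverse.\<close>

lemma sublinearI:
  assumes add: "\<And>x y. p (x + y) \<le> p x + p y"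
    and scale: "\<And>r x. 0 < r \<Longrightarrow> p (r *\<^sub>R x) \<le> r * p x"
    and zero: "p 0 = 0"
  shows "sublinear p"
  unfolding sublinear_def
proof (intro conjI allI impI add)
  fix r :: real and x assume "0 \<le> r"
  show "p (r *\<^sub>R x) = r * p x"
  proof (cases "r = 0")
    case True
    then show ?thesis by (simp add: zero)
  next
    case False
    then have r: "0 < r" using \<open>0 \<le> r\<close> by simp
    have "p ((1 / r) *\<^sub>R (r *\<^sub>R x)) \<le> (1 / r) * p (r *\<^sub>R x)"
      using r by (intro scale) simp
    then have "r * p x \<le> p (r *\<^sub>R x)" using r by (simp add: field_simps)
    then show ?thesis using scale[OF r, of x] by simp
  qed
qed

text \<open>
  With \<open>C\<close> a convex cone this is the infimal convolution of \<open>p\<close> with the constraints \<open>f k \<ge> n\<close>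
  for \<open>(k, n) \<in> C\<close>: every linear \<open>f \<le> q\<close> satisfies them.
\<close>

lemma sublinear_shrink:
  fixes p :: "'v::real_vector \<Rightarrow> real" and C :: "('v \<times> real) set"
  assumes p: "sublinear p" and C0: "0 \<in> C"
    and Cadd: "\<And>a b. a \<in> C \<Longrightarrow> b \<in> C \<Longrightarrow> a + b \<in> C"
    and Cscale: "\<And>r a. 0 < r \<Longrightarrow> a \<in> C \<Longrightarrow> r *\<^sub>R a \<in> C"
    and le: "\<And>k n. (k, n) \<in> C \<Longrightarrow> n \<le> p k"
  obtains q where "sublinear q" "\<And>v. q v \<le> p v" "\<And>k n. (k, n) \<in> C \<Longrightarrow> q (- k) \<le> - n"
proof
  define q where "q v = (INF a\<in>C. p (v + fst a) - snd a)" for v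
  have bdd: "bdd_below ((\<lambda>a. p (v + fst a) - snd a) ` C)" for v
  proof (rule bdd_belowI2)
    fix a assume "a \<in> C"
    then have "snd a \<le> p (fst a)" using le[of "fst a" "snd a"] by simp
    moreover have "p (fst a) \<le> p (v + fst a) + p (- v)"
      using sublinear_add[OF p, of "v + fst a" "- v"] by simp
    ultimately show "- p (- v) \<le> p (v + fst a) - snd a" by simp
  qed
  have low: "q v \<le> p (v + fst a) - snd a" if "a \<in> C" for a v
    unfolding q_def using bdd that by (rule cINF_lower)
  have great: "m \<le> q v" if "\<And>a. a \<in> C \<Longrightarrow> m \<le> p (v + fst a) - snd a" for m v
    unfolding q_def using C0 that by (intro cINF_greatest) auto
  show qp: "q v \<le> p v" for v using low[OF C0, of v] by simp
  show neg: "q (- k) \<le> - n" if "(k, n) \<in> C" for k n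
    using low[OF that, of "- k"] sublinear_zero[OF p] by simp
  show "sublinear q"
  proof (rule sublinearI)
    show "q 0 = 0"
    proof (rule antisym)
      show "q 0 \<le> 0" using qp[of 0] sublinear_zero[OF p] by simp
      show "0 \<le> q 0" using le by (intro great) (metis add_0 diff_ge_0_iff_ge prod.collapse)
    qed
  next
    fix x y
    \<comment> \<open>The two infima are treated one at a time: \<open>a\<close> is admissible at
      \<open>x\<close> and \<open>b\<close> at \<open>y\<close>, hence \<open>a + b\<close> at
      \<open>x + y\<close>.\<close>
    have "q (x + y) - q y \<le> q x"
    proof (rule great)
      fix a assume a: "a \<in> C"
      have "q (x + y) - (p (x + fst a) - snd a) \<le> q y"
      proof (rule great)
        fix b assume b: "b \<in> C"
        have "q (x + y) \<le> p ((x + y) + fst (a + b)) - snd (a + b)"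
          by (rule low[OF Cadd[OF a b]])
        also have "(x + y) + fst (a + b) = (x + fst a) + (y + fst b)" by simp
        finally show "q (x + y) - (p (x + fst a) - snd a) \<le> p (y + fst b) - snd b"
          using sublinear_add[OF p, of "x + fst a" "y + fst b"] by simp
      qed
      then show "q (x + y) - q y \<le> p (x + fst a) - snd a" by simp
    qed
    then show "q (x + y) \<le> q x + q y" by simp
  next
    fix r :: real and x assume r: "0 < r"
    have "q (r *\<^sub>R x) / r \<le> q x"
    proof (rule great)
      fix a assume a: "a \<in> C"
      have "q (r *\<^sub>R x) \<le> p (r *\<^sub>R x + fst (r *\<^sub>R a)) - snd (r *\<^sub>R a)"
        by (rule low[OF Cscale[OF r a]])
      also have "r *\<^sub>R x + fst (r *\<^sub>R a) = r *\<^sub>R (x + fst a)" by (simp add: scaleR_add_right)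
      finally show "q (r *\<^sub>R x) / r \<le> p (x + fst a) - snd a"
        using r sublinear_scale[OF p, of r "x + fst a"] by (simp add: field_simps)
    qed
    then show "q (r *\<^sub>R x) \<le> r * q x" using r by (simp add: field_simps)
  qed
qed

text \<open>In general \<open>x\<close> and \<open>y\<close> may call for different members of the
  family, which spoils subadditivity of the infimum. In a chain the smaller of the two members
  serves both points.\<close>

lemma sublinear_INF_chain:
  fixes C :: "('v::real_vector \<Rightarrow> real) set"
  assumes ne: "C \<noteq> {}" and sub: "\<And>q. q \<in> C \<Longrightarrow> sublinear q"
    and chain: "\<And>q r. q \<in> C \<Longrightarrow> r \<in> C \<Longrightarrow> q \<le> r \<or> r \<le> q"
    and bdd: "\<And>v. bdd_below ((\<lambda>q. q v) ` C)"
  shows "sublinear (\<lambda>v. INF q\<in>C. q v)"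
proof (rule sublinearI)
  let ?q = "\<lambda>v. INF q\<in>C. q v"
  have low: "?q v \<le> q v" if "q \<in> C" for q v using bdd that by (rule cINF_lower)
  have "(\<lambda>q. q 0) ` C = {0}" using ne sublinear_zero[OF sub] by force
  then show "?q 0 = 0" by simp
  show "?q (x + y) \<le> ?q x + ?q y" for x y
  proof -
    have "?q (x + y) - ?q y \<le> ?q x"
    proof (rule cINF_greatest[OF ne])
      fix q assume q: "q \<in> C"
      have "?q (x + y) - q x \<le> ?q y"
      proof (rule cINF_greatest[OF ne])
        fix r assume r: "r \<in> C"
        obtain s where s: "s \<in> C" "s \<le> q" "s \<le> r" using chain[OF q r] q r by blast
        have "?q (x + y) \<le> s x + s y"
          using low[OF s(1), of "x + y"] sublinear_add[OF sub[OF s(1)], of x y] by simp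
        also have "\<dots> \<le> q x + r y" using s by (simp add: le_fun_def add_mono)
        finally show "?q (x + y) - q x \<le> r y" by simp
      qed
      then show "?q (x + y) - ?q y \<le> q x" by simp
    qed
    then show ?thesis by simp
  qed
  show "?q (r *\<^sub>R x) \<le> r * ?q x" if r: "0 < r" for r x
  proof -
    have "?q (r *\<^sub>R x) / r \<le> ?q x"
    proof (rule cINF_greatest[OF ne])
      fix q assume q: "q \<in> C"
      show "?q (r *\<^sub>R x) / r \<le> q x"
        using r low[OF q, of "r *\<^sub>R x"] sublinear_scale[OF sub[OF q], of r x] by (simp add: field_simps)
    qed
    then show ?thesis using r by (simp add: field_simps)
  qed
qed

text \<open>Shrinking \<open>m\<close> along the ray through \<open>(a, m a)\<close> gives a
  sublinear map below \<open>m\<close>, which equals \<open>m\<close> by minimality. So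
  \<open>m (- a) <= - m a\<close>, and this turns subadditivity into additivity.\<close>

lemma minimal_sublinear_linear:
  assumes m: "sublinear m" and min: "\<And>q. sublinear q \<Longrightarrow> q \<le> m \<Longrightarrow> q = m"
  shows "linear m"
proof -
  have "m v + m a \<le> m (v + a)" for v a
  proof -
    let ?C = "{(s *\<^sub>R a, s * m a) |s. 0 \<le> s}"
    obtain q where q: "sublinear q" "\<And>v. q v \<le> m v" "\<And>k n. (k, n) \<in> ?C \<Longrightarrow> q (- k) \<le> - n"
    proof (rule sublinear_shrink[OF m, of ?C])
      show "0 \<in> ?C" by (auto simp: zero_prod_def intro!: exI[of _ 0])
      show "x + y \<in> ?C" if xy: "x \<in> ?C" "y \<in> ?C" for x y
      proof -
        obtain s t where "0 \<le> s" "0 \<le> t" "x = (s *\<^sub>R a, s * m a)" "y = (t *\<^sub>R a, t * m a)"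
          using xy by auto
        then show ?thesis by (auto simp: algebra_simps intro!: exI[of _ "s + t"])
      qed
      show "r *\<^sub>R x \<in> ?C" if r: "0 < r" and x: "x \<in> ?C" for r x
      proof -
        obtain s where "0 \<le> s" "x = (s *\<^sub>R a, s * m a)" using x by auto
        then show ?thesis using r by (auto intro!: exI[of _ "r * s"])
      qed
    qed (auto simp: sublinear_scale[OF m])
    have "q = m" using q by (intro min) (auto simp: le_fun_def)
    moreover have "(a, m a) \<in> ?C" by (auto intro!: exI[of _ 1])
    ultimately have "m (- a) \<le> - m a" using q(3) by blast
    then show ?thesis using sublinear_add[OF m, of "v + a" "- a"] by simp
  qed
  then have add: "m (v + a) = m v + m a" for v a
    using sublinear_add[OF m] by (simp add: antisym)
  have neg: "m (- v) = - m v" for v using add[of v "- v"] sublinear_zero[OF m] by simp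
  have "m (r *\<^sub>R v) = r * m v" for r v
  proof (cases "0 \<le> r")
    case False
    then have "m (- ((- r) *\<^sub>R v)) = - ((- r) * m v)"
      unfolding neg using sublinear_scale[OF m, of "- r" v] by simp
    then show ?thesis by simp
  qed (simp add: sublinear_scale[OF m])
  then show ?thesis using add by (intro linearI) auto
qed

lemma linear_le_sublinear:
  fixes p :: "'v::real_vector \<Rightarrow> real"
  assumes p: "sublinear p"
  obtains f where "linear f" "\<And>v. f v \<le> p v"
proof -
  define A where "A = {q. sublinear q \<and> q \<le> p}"
  have "\<exists>m\<in>A. \<forall>q\<in>A. q \<le> m \<longrightarrow> q = m"
  proof (rule predicate_Zorn)
    \<comment> \<open>The order is reversed, so that the maximal element from Zorn's lemma is a
      minimal sublinear map.\<close>
    show "partial_order_on A (relation_of (\<lambda>x y. y \<le> x) A)"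
      by (rule partial_order_on_relation_ofI) auto
  next
    fix C assume C: "C \<in> Chains (relation_of (\<lambda>x y. y \<le> x) A)"
    have CA: "C \<subseteq> A" using C by (auto simp: Chains_def relation_of_def)
    have ch: "q \<le> r \<or> r \<le> q" if "q \<in> C" "r \<in> C" for q r
      using C that by (auto simp: Chains_def relation_of_def)
    show "\<exists>u\<in>A. \<forall>a\<in>C. u \<le> a"
    proof (cases "C = {}")
      case True
      then show ?thesis using p by (auto simp: A_def)
    next
      case False
      have bdd: "bdd_below ((\<lambda>q. q v) ` C)" for v
      proof (rule bdd_belowI2)
        fix q assume "q \<in> C"
        then have "sublinear q" "q (- v) \<le> p (- v)" using CA by (auto simp: A_def le_fun_def)
        then show "- p (- v) \<le> q v" using sublinear_neg[of q v] by simp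
      qed
      define u where "u v = (INF q\<in>C. q v)" for v
      have low: "u \<le> q" if "q \<in> C" for q
        unfolding u_def le_fun_def using bdd that by (auto intro: cINF_lower)
      have "sublinear u" unfolding u_def
        using False CA ch bdd by (intro sublinear_INF_chain) (auto simp: A_def)
      moreover obtain q where "q \<in> C" using False by blast
      then have "u \<le> p" using low[of q] CA by (auto simp: A_def)
      ultimately show ?thesis using low by (auto simp: A_def)
    qed
  qed
  then obtain m where m: "sublinear m" "m \<le> p" "\<And>q. sublinear q \<Longrightarrow> q \<le> m \<Longrightarrow> q = m"
    unfolding A_def by (auto intro: order_trans)
  then have "linear m" by (intro minimal_sublinear_linear)
  then show ?thesis using m(2) that by (auto simp: le_fun_def)
qed

text \<open>The cone \<open>?C\<close> encodes \<open>f w >= d\<close> together with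
  \<open>f h >= 0\<close> on \<open>H\<close>; the distance hypothesis, scaled by \<open>s\<close>,
  makes it compatible with the norm. On a subspace, \<open>f >= 0\<close> at \<open>h\<close> and
  \<open>- h\<close> forces \<open>f h = 0\<close>.\<close>

lemma norming_functional:
  fixes w :: "'v::real_normed_vector" and H :: "'v set"
  assumes H: "subspace H" and dist: "\<And>h. h \<in> H \<Longrightarrow> d \<le> norm (w + h)"
  obtains f where "linear f" "\<And>v. f v \<le> norm v" "d \<le> f w" "\<And>h. h \<in> H \<Longrightarrow> f h = 0"
proof -
  let ?C = "{(s *\<^sub>R w + h, s * d) |s h. 0 \<le> s \<and> h \<in> H}"
  have norm: "sublinear (norm :: 'v \<Rightarrow> real)"
    by (simp add: sublinear_def norm_triangle_ineq)
  obtain q where q: "sublinear q" "\<And>v. q v \<le> norm (v :: 'v)" "\<And>k n. (k, n) \<in> ?C \<Longrightarrow> q (- k) \<le> - n"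
  proof (rule sublinear_shrink[OF norm, of ?C])
    show "0 \<in> ?C" using subspace_0[OF H] by (auto simp: zero_prod_def intro!: exI[of _ 0])
    show "x + y \<in> ?C" if xy: "x \<in> ?C" "y \<in> ?C" for x y
    proof -
      obtain s h t g where "0 \<le> s" "0 \<le> t" "h \<in> H" "g \<in> H"
        "x = (s *\<^sub>R w + h, s * d)" "y = (t *\<^sub>R w + g, t * d)"
        using xy by auto
      then show ?thesis using subspace_add[OF H]
        by (auto simp: algebra_simps intro!: exI[of _ "s + t"] exI[of _ "h + g"])
    qed
    show "r *\<^sub>R x \<in> ?C" if r: "0 < r" and x: "x \<in> ?C" for r x
    proof -
      obtain s h where "0 \<le> s" "h \<in> H" "x = (s *\<^sub>R w + h, s * d)" using x by auto
      then show ?thesis using r subspace_scale[OF H]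
        by (auto simp: algebra_simps intro!: exI[of _ "r * s"] exI[of _ "r *\<^sub>R h"])
    qed
    fix k n assume "(k, n) \<in> ?C"
    then obtain s h where sh: "0 \<le> s" "h \<in> H" "k = s *\<^sub>R w + h" "n = s * d" by auto
    show "n \<le> norm k"
    proof (cases "s = 0")
      case False
      then have s: "0 < s" using sh by simp
      have "d \<le> norm (w + (1 / s) *\<^sub>R h)" using sh subspace_scale[OF H] by (intro dist)
      then have "s * d \<le> norm (s *\<^sub>R (w + (1 / s) *\<^sub>R h))" using s by simp
      then show ?thesis using sh s by (simp add: scaleR_add_right)
    qed (simp add: sh)
  qed blast
  obtain f where f: "linear f" "\<And>v. f v \<le> q v" using linear_le_sublinear[OF q(1)] by blast
  have le: "n \<le> f k" if "(k, n) \<in> ?C" for k n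
    using q(3)[OF that] f(2)[of "- k"] linear_neg[OF f(1)] by simp
  have pos: "0 \<le> f h" if "h \<in> H" for h
    using le[of h 0] that by (force intro: exI[of _ 0])
  show ?thesis
  proof
    show "linear f" "\<And>v. f v \<le> norm v" using f q(2) by (auto intro: order_trans)
    show "d \<le> f w" using le[of w d] subspace_0[OF H] by (force intro: exI[of _ 1])
    show "f h = 0" if "h \<in> H" for h
      using pos[OF that] pos[OF subspace_neg[OF H that]] linear_neg[OF f(1)] by simp
  qed
qed

section \<open>Norm and spectrum\<close>

lemma invertible_elemI: "a * b = 1 \<Longrightarrow> b * a = 1 \<Longrightarrow> invertible_elem a"
  by (auto simp: invertible_elem_def)

lemma invertible_elem_mult:
  assumes "invertible_elem a" "invertible_elem b"
  shows "invertible_elem (a * b)"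
proof -
  obtain c d where c: "a * c = 1" "c * a = 1" and d: "b * d = 1" "d * b = 1"
    using assms by (auto simp: invertible_elem_def)
  have "(a * b) * (d * c) = a * (b * d) * c" "(d * c) * (a * b) = d * (c * a) * b"
    by (simp_all only: mult.assoc)
  then show ?thesis using c d by (intro invertible_elemI[of _ "d * c"]) simp_all
qed

lemma invertible_elem_scaleR:
  fixes a :: "'a::real_algebra_1"
  assumes "invertible_elem a" "r \<noteq> 0"
  shows "invertible_elem (r *\<^sub>R a)"
proof -
  obtain c where "a * c = 1" "c * a = 1"
    using assms(1) by (auto simp: invertible_elem_def)
  then show ?thesis using assms(2) by (intro invertible_elemI[of _ "(1 / r) *\<^sub>R c"]) simp_all
qed

lemma invertible_elem_one_minus:
  fixes x :: "'a::{real_normed_algebra_1, banach}"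
  assumes "norm x < 1"
  shows "invertible_elem (1 - x)"
proof -
  let ?s = "\<Sum>n. x ^ n"
  have summ: "summable (\<lambda>n. x ^ n)" using assms by (rule complete_algebra_summable_geometric)
  have split: "?s = 1 + (\<Sum>n. x ^ Suc n)"
    using suminf_split_initial_segment[OF summ, of 1] by (simp add: add.commute)
  have "?s = 1 + x * ?s" unfolding power_Suc using split suminf_mult[OF summ, of x] by simp
  moreover have "?s = 1 + ?s * x"
    using split suminf_mult2[OF summ, of x] by (simp add: power_commutes)
  ultimately show ?thesis
    by (intro invertible_elemI[of _ ?s]) (simp_all add: algebra_simps)
qed

text \<open>For \<open>s\<close> near \<open>t\<close> the identity bounds \<open>norm (g s)\<close>
  by \<open>norm (g t)\<close> plus half of itself. Absorbing that half gives a local bound, which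
  bisection makes uniform.\<close>

lemma bounded_inverse_family:
  fixes x :: "'a::real_normed_algebra" and g :: "real \<Rightarrow> 'a"
  assumes "a \<le> b"
    and res: "\<And>s t. s \<in> {a..b} \<Longrightarrow> t \<in> {a..b} \<Longrightarrow> g s - g t = (s - t) *\<^sub>R (g s * x * g t)"
  obtains M where "\<And>t. t \<in> {a..b} \<Longrightarrow> norm (g t) \<le> M"
proof -
  \<comment> \<open>The intersection is taken because the local condition of the bisection rule also
    tests intervals that leave \<open>{a..b}\<close>.\<close>
  let ?P = "\<lambda>u v. \<exists>M. \<forall>t\<in>{u..v} \<inter> {a..b}. norm (g t) \<le> M"
  have "?P a b"
  proof (rule Bolzano[where P = ?P, OF \<open>a \<le> b\<close>])
    fix u v w assume "?P u v" "?P v w"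
    then obtain M N where MN: "\<forall>t\<in>{u..v} \<inter> {a..b}. norm (g t) \<le> M" "\<forall>t\<in>{v..w} \<inter> {a..b}. norm (g t) \<le> N"
      by blast
    have "norm (g t) \<le> max M N" if "t \<in> {u..w} \<inter> {a..b}" for t
      using MN that by (cases "t \<le> v") (auto simp: le_max_iff_disj)
    then show "?P u w" by blast
  next
    fix t assume t: "a \<le> t" "t \<le> b"
    \<comment> \<open>Chosen so that \<open>d * (norm x * norm (g t)) <= 1 / 2\<close>; the
      \<open>+ 1\<close> prevents division by zero.\<close>
    define d where "d = 1 / (2 * (norm x * norm (g t) + 1))"
    have pos: "0 < 2 * (norm x * norm (g t) + 1)" by (simp add: add_nonneg_pos)
    then have d: "0 < d" by (simp add: d_def)
    have "norm (g s) \<le> 2 * norm (g t)" if s: "s \<in> {a..b}" "\<bar>s - t\<bar> \<le> d" for s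
    proof -
      have "norm (g s) \<le> norm (g t) + norm (g s - g t)" by (metis add.commute norm_triangle_sub)
      also have "norm (g s - g t) = \<bar>s - t\<bar> * norm (g s * x * g t)"
        using res[of s t] s t by simp
      also have "\<dots> \<le> d * (norm (g s) * norm x * norm (g t))"
      proof (intro mult_mono s)
        show "norm (g s * x * g t) \<le> norm (g s) * norm x * norm (g t)"
          by (meson mult_right_mono norm_ge_zero norm_mult_ineq order_trans)
      qed (use d in auto)
      also have "\<dots> = norm (g s) * (d * (norm x * norm (g t)))" by simp
      also have "\<dots> \<le> norm (g s) * (1 / 2)"
      proof (rule mult_left_mono)
        show "d * (norm x * norm (g t)) \<le> 1 / 2"
          using pos by (simp add: d_def field_simps)
      qed simp
      finally show ?thesis by simp
    qed
    then have "?P u v" if "u \<le> t \<and> t \<le> v \<and> v - u < d" for u v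
      using that by (intro exI[of _ "2 * norm (g t)"]) auto
    then show "\<exists>d>0. \<forall>u v. u \<le> t \<and> t \<le> v \<and> v - u < d \<longrightarrow> ?P u v" using d by blast
  qed
  then show ?thesis using that by (metis Int_absorb)
qed

section \<open>Poisson kernels\<close>

lemma cos_lipschitz: "\<bar>cos s - cos t\<bar> \<le> \<bar>s - t\<bar>" for s t :: real
proof -
  have "cos s - cos t = 2 * sin ((s + t) / 2) * sin ((t - s) / 2)" by (rule cos_diff_cos)
  then have "\<bar>cos s - cos t\<bar> = 2 * \<bar>sin ((s + t) / 2)\<bar> * \<bar>sin ((t - s) / 2)\<bar>" by (simp add: abs_mult)
  also have "\<dots> \<le> 2 * 1 * \<bar>(t - s) / 2\<bar>"
    by (intro mult_mono abs_sin_x_le_abs_x) auto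
  finally show ?thesis by simp
qed

text \<open>
  \<open>K t\<close> stands for the Poisson kernel \<open>(1 - u\<^sup>2) / (1 - 2 u cos t + u\<^sup>2)\<close> of an algebra element \<open>u\<close>.
  The kernel of \<open>u\<^sup>2\<close> at \<open>2 t\<close> is the mean of the kernels of \<open>u\<close> at \<open>t\<close> and \<open>t + \<pi>\<close>, so repeated
  squaring halves the Lipschitz constant \<open>L\<close> each time. The value at \<open>0\<close> minus that at \<open>\<pi>\<close> is
  \<open>4 u / (1 - u\<^sup>2)\<close>, hence small, which is impossible when all powers \<open>u\<^bsup>2^k\<^esup>\<close> have norm \<open>1\<close>.
\<close>

definition poisson_kernel :: "'a::real_normed_algebra_1 \<Rightarrow> real \<Rightarrow> (real \<Rightarrow> 'a) \<Rightarrow> bool" where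
  "poisson_kernel u L K \<longleftrightarrow>
     (\<forall>t. K t * (1 + u * u - (2 * cos t) *\<^sub>R u) = 1 - u * u) \<and>
     K 0 * (1 - u) = 1 + u \<and> K pi * (1 + u) = 1 - u \<and>
     (\<forall>s t. norm (K s - K t) \<le> L * \<bar>s - t\<bar>)"

lemma poisson_kernel_square:
  assumes "poisson_kernel u L K"
  shows "poisson_kernel (u * u) (L / 2) (\<lambda>t. (1 / 2) *\<^sub>R (K (t / 2) + K (t / 2 + pi)))"
    (is "poisson_kernel _ _ ?K")
proof -
  have K: "K t * (1 + u * u - (2 * cos t) *\<^sub>R u) = 1 - u * u"
    and K0: "K 0 * (1 - u) = 1 + u" and Kpi: "K pi * (1 + u) = 1 - u"
    and L: "norm (K s - K t) \<le> L * \<bar>s - t\<bar>" for s t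
    using assms by (auto simp: poisson_kernel_def)
  have "?K t * (1 + u * u * (u * u) - (2 * cos t) *\<^sub>R (u * u)) = 1 - u * u * (u * u)" for t
  proof -
    define c where "c = cos (t / 2)"
    \<comment> \<open>\<open>?q'\<close> is the denominator at \<open>t / 2 + pi\<close>, where the
      cosine changes sign. The product
      \<open>(1 + u\<^sup>2)\<^sup>2 - 4 c\<^sup>2 u\<^sup>2\<close> is the denominator for
      \<open>u * u\<close> at \<open>t\<close>.\<close>
    let ?q = "1 + u * u - (2 * c) *\<^sub>R u" and ?q' = "1 + u * u + (2 * c) *\<^sub>R u"
    have cos: "cos t = 2 * c\<^sup>2 - 1" using cos_double_cos[of "t / 2"] by (simp add: c_def)
    have Q: "1 + u * u * (u * u) - (2 * cos t) *\<^sub>R (u * u) = ?q * ?q'"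
      and Q': "?q * ?q' = ?q' * ?q"
      by (simp_all add: cos algebra_simps power2_eq_square scaleR_2)
    have "K (t / 2) * (?q * ?q') = (1 - u * u) * ?q'"
      using K[of "t / 2"] by (simp only: c_def mult.assoc[symmetric])
    moreover have "K (t / 2 + pi) * (?q * ?q') = (1 - u * u) * ?q"
      unfolding Q' using K[of "t / 2 + pi"] by (simp add: c_def mult.assoc[symmetric])
    ultimately have "?K t * (?q * ?q') = (1 / 2) *\<^sub>R ((1 - u * u) * ?q' + (1 - u * u) * ?q)"
      by (simp only: mult_scaleR_left distrib_right)
    also have "\<dots> = (1 / 2) *\<^sub>R (2 *\<^sub>R (1 - u * u * (u * u)))"
      unfolding scaleR_2 by (simp add: algebra_simps)
    finally show ?thesis unfolding Q by simp
  qed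
  \<comment> \<open>The values at \<open>0\<close> and \<open>pi\<close> are carried along with one
    factor already cancelled, since \<open>poisson_kernel\<close> does not assert that
    \<open>1 - u\<close> and \<open>1 + u\<close> are invertible.\<close>
  moreover have "?K 0 * (1 - u * u) = 1 + u * u"
  proof -
    have "K 0 * (1 - u * u) = K 0 * (1 - u) * (1 + u)" "K pi * (1 - u * u) = K pi * (1 + u) * (1 - u)"
      by (simp_all add: algebra_simps)
    then have "?K 0 * (1 - u * u) = (1 / 2) *\<^sub>R ((1 + u) * (1 + u) + (1 - u) * (1 - u))"
      by (simp add: K0 Kpi distrib_right)
    also have "\<dots> = (1 / 2) *\<^sub>R (2 *\<^sub>R (1 + u * u))" unfolding scaleR_2 by (simp add: algebra_simps)
    finally show ?thesis by simp
  qed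
  moreover have "?K pi * (1 + u * u) = 1 - u * u"
  proof -
    have c: "cos (pi / 2 + pi) = 0" by (simp only: cos_periodic_pi cos_pi_half minus_zero)
    have "K (pi / 2) * (1 + u * u) = 1 - u * u" "K (pi / 2 + pi) * (1 + u * u) = 1 - u * u"
      using K[of "pi / 2"] K[of "pi / 2 + pi", unfolded c] by simp_all
    then have "?K pi * (1 + u * u) = (1 / 2) *\<^sub>R (2 *\<^sub>R (1 - u * u))"
      unfolding scaleR_2 by (simp only: mult_scaleR_left distrib_right)
    then show ?thesis by simp
  qed
  moreover have "norm (?K s - ?K t) \<le> L / 2 * \<bar>s - t\<bar>" for s t
  proof -
    have "?K s - ?K t = (1 / 2) *\<^sub>R ((K (s / 2) - K (t / 2)) + (K (s / 2 + pi) - K (t / 2 + pi)))"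
      by (simp add: algebra_simps)
    then have "norm (?K s - ?K t) = (1 / 2) * norm ((K (s / 2) - K (t / 2)) + (K (s / 2 + pi) - K (t / 2 + pi)))"
      by simp
    also have "\<dots> \<le> (1 / 2) * (L * \<bar>s / 2 - t / 2\<bar> + L * \<bar>(s / 2 + pi) - (t / 2 + pi)\<bar>)"
      by (intro mult_left_mono norm_triangle_mono L) simp
    also have "\<dots> = L / 2 * \<bar>s - t\<bar>" by (simp add: diff_divide_distrib[symmetric])
    finally show ?thesis .
  qed
  ultimately show ?thesis unfolding poisson_kernel_def by blast
qed

lemma poisson_kernel_bound:
  fixes u :: "'a::real_normed_algebra_1"
  assumes "poisson_kernel u L K"
  shows "4 * norm u \<le> L * pi * (1 + norm u)\<^sup>2"
proof -
  have "(K 0 - K pi) * (1 - u) * (1 + u) = K 0 * (1 - u) * (1 + u) - K pi * (1 + u) * (1 - u)"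
    by (simp add: algebra_simps)
  also have "\<dots> = (1 + u) * (1 + u) - (1 - u) * (1 - u)"
    using assms by (simp add: poisson_kernel_def)
  also have "\<dots> = 2 *\<^sub>R 2 *\<^sub>R u" unfolding scaleR_2 by (simp add: algebra_simps)
  finally have "4 * norm u = norm ((K 0 - K pi) * (1 - u) * (1 + u))" by simp
  also have "\<dots> \<le> norm (K 0 - K pi) * norm (1 - u) * norm (1 + u)"
    by (meson mult_right_mono norm_ge_zero norm_mult_ineq order_trans)
  also have "\<dots> \<le> (L * pi) * (1 + norm u) * (1 + norm u)"
  proof (intro mult_mono)
    have "norm (K 0 - K pi) \<le> L * \<bar>0 - pi\<bar>" using assms by (simp only: poisson_kernel_def)
    then show *: "norm (K 0 - K pi) \<le> L * pi" by simp
    then show "0 \<le> L * pi" by (rule order_trans[OF norm_ge_zero])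
    then show "0 \<le> L * pi * (1 + norm u)" by simp
    show "norm (1 - u) \<le> 1 + norm u" using norm_triangle_ineq4[of 1 u] by simp
    show "norm (1 + u) \<le> 1 + norm u" using norm_triangle_ineq[of 1 u] by simp
  qed auto
  finally show ?thesis by (simp add: power2_eq_square mult.assoc)
qed

text \<open>The inverses of the denominators, as a function \<open>g\<close> of
  \<open>c = cos t\<close>, satisfy a resolvent identity. It makes \<open>g\<close> bounded on
  \<open>{-1..1}\<close> and then Lipschitz in \<open>c\<close>; the cosine is 1-Lipschitz, so the
  kernel is Lipschitz in \<open>t\<close>.\<close>

lemma poisson_kernel_exists:
  fixes x :: "'a::real_normed_algebra_1"
  assumes inv: "\<And>c. \<bar>c\<bar> \<le> 1 \<Longrightarrow> invertible_elem (1 + x * x - (2 * c) *\<^sub>R x)"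
    and inv1: "invertible_elem (1 - x)" "invertible_elem (1 + x)"
  obtains L K where "poisson_kernel x L K"
proof -
  let ?Q = "\<lambda>c. 1 + x * x - (2 * c) *\<^sub>R x"
  obtain g where g: "\<And>c. \<bar>c\<bar> \<le> 1 \<Longrightarrow> ?Q c * g c = 1" "\<And>c. \<bar>c\<bar> \<le> 1 \<Longrightarrow> g c * ?Q c = 1"
    using inv unfolding invertible_elem_def by metis
  have res: "g s - g t = (s - t) *\<^sub>R (g s * (2 *\<^sub>R x) * g t)" if "\<bar>s\<bar> \<le> 1" "\<bar>t\<bar> \<le> 1" for s t
  proof -
    have "g s - g t = g s * (?Q t * g t) - (g s * ?Q s) * g t" using g that by simp
    also have "\<dots> = g s * (?Q t - ?Q s) * g t" by (simp only: algebra_simps)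
    also have "?Q t - ?Q s = (s - t) *\<^sub>R (2 *\<^sub>R x)" by (simp add: algebra_simps)
    finally show ?thesis by simp
  qed
  obtain M where M: "\<And>t. t \<in> {-1..1} \<Longrightarrow> norm (g t) \<le> M"
    using bounded_inverse_family[of "-1" 1 g "2 *\<^sub>R x"] res by (auto simp: abs_le_iff)
  have M0: "0 \<le> M" using order_trans[OF norm_ge_zero M[of 0]] by simp
  define K where "K t = (1 - x * x) * g (cos t)" for t
  define L where "L = norm (1 - x * x) * (M * norm (2 *\<^sub>R x) * M)"
  have KQ: "K t * ?Q (cos t) = 1 - x * x" for t
    using g(2)[of "cos t"] by (simp add: K_def mult.assoc)
  have cancel: "y = z" if "y * a = z * a" "invertible_elem a" for y z a :: 'a
    using that unfolding invertible_elem_def by (metis mult.assoc mult.right_neutral)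
  have "K 0 * (1 - x) = 1 + x"
  proof (rule cancel[OF _ inv1(1)])
    have "?Q 1 = (1 - x) * (1 - x)" by (simp add: algebra_simps scaleR_2)
    then show "K 0 * (1 - x) * (1 - x) = (1 + x) * (1 - x)"
      using KQ[of 0] by (simp add: mult.assoc) (simp add: algebra_simps)
  qed
  moreover have "K pi * (1 + x) = 1 - x"
  proof (rule cancel[OF _ inv1(2)])
    have "?Q (- 1) = (1 + x) * (1 + x)" by (simp add: algebra_simps scaleR_2)
    then show "K pi * (1 + x) * (1 + x) = (1 - x) * (1 + x)"
      using KQ[of pi] by (simp add: mult.assoc) (simp add: algebra_simps)
  qed
  moreover have "norm (K s - K t) \<le> L * \<bar>s - t\<bar>" for s t
  proof -
    let ?d = "g (cos s) * (2 *\<^sub>R x) * g (cos t)"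
    have eq: "K s - K t = (1 - x * x) * ((cos s - cos t) *\<^sub>R ?d)"
      by (simp only: K_def res[symmetric] abs_cos_le_one right_diff_distrib)
    have "norm (K s - K t) \<le> norm (1 - x * x) * (\<bar>cos s - cos t\<bar> * norm ?d)"
      unfolding eq norm_scaleR[of "cos s - cos t", symmetric] by (rule norm_mult_ineq)
    also have "\<dots> \<le> norm (1 - x * x) * (\<bar>s - t\<bar> * (M * norm (2 *\<^sub>R x) * M))"
    proof (intro mult_left_mono mult_mono cos_lipschitz)
      have "norm ?d \<le> norm (g (cos s)) * norm (2 *\<^sub>R x) * norm (g (cos t))"
        by (meson mult_right_mono norm_ge_zero norm_mult_ineq order_trans)
      also have "\<dots> \<le> M * norm (2 *\<^sub>R x) * M"
        using M0 by (intro mult_mono M) auto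
      finally show "norm ?d \<le> M * norm (2 *\<^sub>R x) * M" .
    qed auto
    finally show ?thesis by (simp add: L_def mult_ac)
  qed
  ultimately have "poisson_kernel x L K" using KQ by (simp add: poisson_kernel_def)
  then show ?thesis by (rule that)
qed

lemma not_all_invertible_on_circle:
  fixes x :: "'a::real_normed_algebra_1"
  assumes norm: "\<And>k. norm (x ^ 2 ^ k) = 1"
    and inv: "\<And>c. \<bar>c\<bar> \<le> 1 \<Longrightarrow> invertible_elem (1 + x * x - (2 * c) *\<^sub>R x)"
    and inv1: "invertible_elem (1 - x)" "invertible_elem (1 + x)"
  shows False
proof -
  obtain L K where K: "poisson_kernel x L K" using inv inv1 by (rule poisson_kernel_exists)
  have "\<exists>K. poisson_kernel (x ^ 2 ^ k) (L / 2 ^ k) K" for k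
  proof (induction k)
    case (Suc k)
    then obtain K' where K': "poisson_kernel (x ^ 2 ^ k) (L / 2 ^ k) K'" by blast
    have "x ^ 2 ^ Suc k = x ^ 2 ^ k * x ^ 2 ^ k" by (simp only: power_Suc mult_2 power_add)
    moreover have "L / 2 ^ Suc k = L / 2 ^ k / 2" by simp
    ultimately show ?case using poisson_kernel_square[OF K'] by (simp only:) (rule exI)
  qed (use K in auto)
  \<comment> \<open>After \<open>k\<close> squarings the bound at norm \<open>1\<close> reads
    \<open>4 <= 4 * L * pi / 2 ^ k\<close>, which fails once \<open>2 ^ k\<close> exceeds
    \<open>L * pi\<close>.\<close>
  moreover obtain k where k: "L * pi < 2 ^ k" using real_arch_pow[of 2 "L * pi"] by auto
  ultimately obtain K' where "poisson_kernel (x ^ 2 ^ k) (L / 2 ^ k) K'" by blast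
  from poisson_kernel_bound[OF this] have "2 ^ k \<le> L * pi" by (simp add: norm field_simps)
  with k show False by simp
qed

section \<open>Self-adjoint and positive elements\<close>

text \<open>Carrying \<open>\<i>\<close> over along the isomorphism of
  \<open>real_or_complex_cases\<close> allows complex scalars to be handled through one unit
  \<open>i\<close> and real coordinates.\<close>

lemma complex_unit_cases:
  obtains (real) "(\<real> :: 'f::real_or_complex set) = UNIV"
  | (complex) i :: "'f::real_or_complex" where "i * i = - 1" "fcnj i = - i"
      "\<And>z :: 'f. \<exists>s t. z = of_real s + of_real t * i"
proof -
  consider "(\<real> :: 'f set) = UNIV"
    | h :: "complex \<Rightarrow> 'f" where "bij h" "\<forall>x y. h (x + y) = h x + h y" "\<forall>x y. h (x * y) = h x * h y"
      "\<forall>r. h (of_real r) = of_real r" "\<forall>x. h (cnj x) = fcnj (h x)"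
    using real_or_complex_cases[where 'f = 'f] by blast
  then show ?thesis
  proof cases
    case 1
    then show ?thesis by (rule real)
  next
    case (2 h)
    have neg: "h (- z) = - h z" for z
      using 2(2)[rule_format, of z "- z"] 2(4)[rule_format, of 0] by (simp add: eq_neg_iff_add_eq_0 add.commute)
    show ?thesis
    proof (rule complex)
      show "h \<i> * h \<i> = - 1"
        using 2(3)[rule_format, of \<i> \<i>] 2(4)[rule_format, of 1] neg[of 1] by simp
      show "fcnj (h \<i>) = - h \<i>" using 2(5)[rule_format, of \<i>] neg[of \<i>] by simp
      fix z :: 'f
      obtain w where w: "z = h w" using 2(1) by (metis bij_pointE)
      have "z = h (of_real (Re w) + of_real (Im w) * \<i>)" using w complex_eq[of w] by (simp add: mult.commute)
      then have "z = of_real (Re w) + of_real (Im w) * h \<i>"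
        by (simp only: 2(2)[rule_format] 2(3)[rule_format] 2(4)[rule_format])
      then show "\<exists>s t. z = of_real s + of_real t * h \<i>" by blast
    qed
  qed
qed

lemma norm_complex_unit:
  fixes i :: "'f::real_or_complex"
  assumes "i * i = - 1" "fcnj i = - i"
  shows "norm (of_real s + of_real t * i) = sqrt (s\<^sup>2 + t\<^sup>2)"
proof -
  let ?z = "of_real s + of_real t * i"
  have ii: "i * (i * a) = - a" for a using assms(1) by (simp add: mult.assoc[symmetric])
  have "of_real ((norm ?z)\<^sup>2) = fcnj ?z * ?z" by (rule fcnj_mult_self[symmetric])
  also have "fcnj ?z = of_real s - of_real t * i" by (simp add: fcnj_add fcnj_mult fcnj_of_real assms)
  also have "\<dots> * ?z = of_real (s\<^sup>2 + t\<^sup>2)"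
    by (simp add: algebra_simps ii assms(1) power2_eq_square)
  finally have "(norm ?z)\<^sup>2 = s\<^sup>2 + t\<^sup>2" by (simp only: of_real_eq_iff)
  then show ?thesis by (metis norm_ge_zero real_sqrt_unique)
qed

lemma nonneg_Reals_of_realD: "(of_real r :: 'f::real_or_complex) \<in> \<real>\<^sub>\<ge>\<^sub>0 \<Longrightarrow> 0 \<le> r"
  by (auto elim!: nonneg_Reals_cases)

context unital_cstar_algebra
begin

lemma star_one: "star 1 = 1"
  by (metis star_mult star_star mult.right_neutral)

lemma star_scaleR: "star (r *\<^sub>R a) = r *\<^sub>R star a"
  by (metis scaleA_of_real star_scaleA fcnj_of_real)

lemma star_minus: "star (- a) = - star a"
  using star_scaleR[of "- 1" a] by simp

lemma star_diff: "star (a - b) = star a - star b"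
  by (metis diff_conv_add_uminus star_add star_minus)

lemma star_power: "star (a ^ n) = star a ^ n"
  by (induction n) (simp_all add: star_one star_mult power_commutes)

lemmas star_simps = star_star star_one star_add star_diff star_minus star_mult star_scaleR

lemma scaleA_one_mult: "scaleA l 1 * a = scaleA l a" "a * scaleA l 1 = scaleA l a"
  by (simp_all add: scaleA_mult_left scaleA_mult_right)

lemma norm_self_adjoint_square: "star a = a \<Longrightarrow> norm (a * a) = (norm a)\<^sup>2"
  using cstar_identity[of a] by simp

lemma norm_self_adjoint_power: "star a = a \<Longrightarrow> norm (a ^ 2 ^ k) = norm a ^ 2 ^ k"
proof (induction k)
  case (Suc k)
  have "norm (a ^ 2 ^ k * a ^ 2 ^ k) = (norm (a ^ 2 ^ k))\<^sup>2"
    using Suc.prems by (intro norm_self_adjoint_square) (simp add: star_power)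
  then show ?case using Suc by (simp only: power_Suc mult_2 power_add power2_eq_square)
qed simp

section \<open>The spectrum of self-adjoint elements\<close>

lemma spectrum_real_shift:
  "of_real r \<in> spectrum scaleA (s *\<^sub>R 1 - a) \<longleftrightarrow> of_real (s - r) \<in> spectrum scaleA a"
proof -
  have neg: "invertible_elem (- b)" if "invertible_elem b" for b :: 'a
    using invertible_elem_scaleR[OF that, of "- 1"] by simp
  have "scaleA (of_real r) 1 - (s *\<^sub>R 1 - a) = - (scaleA (of_real (s - r)) 1 - a)"
    by (simp add: scaleA_of_real algebra_simps del: of_real_diff)
  then show ?thesis unfolding spectrum_def by (metis mem_Collect_eq minus_minus neg)
qed

text \<open>\<open>l - a\<close> is \<open>l\<close> times \<open>1 - a / l\<close>, which the
  Neumann series inverts when \<open>norm a < norm l\<close>.\<close>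

lemma norm_le_of_spectrum:
  assumes "l \<in> spectrum scaleA a"
  shows "norm l \<le> norm a"
proof (rule ccontr)
  assume "\<not> norm l \<le> norm a"
  then have l: "norm a < norm l" "l \<noteq> 0" by auto
  have "norm (scaleA (inverse l) a) < 1"
    using l by (simp add: norm_scaleA norm_inverse divide_inverse[symmetric] mult.commute)
  then obtain b where b: "(1 - scaleA (inverse l) a) * b = 1" "b * (1 - scaleA (inverse l) a) = 1"
    using invertible_elem_one_minus by (auto simp: invertible_elem_def)
  have eq: "scaleA l 1 - a = scaleA l (1 - scaleA (inverse l) a)"
    using l by (simp add: scale_right_diff_distrib)
  have "invertible_elem (scaleA l 1 - a)" unfolding eq
    by (rule invertible_elemI[of _ "scaleA (inverse l) b"])
      (simp_all add: scaleA_mult_left scaleA_mult_right b l)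
  then show False using assms by (simp add: spectrum_def)
qed

lemma spectrum_shift:
  "l \<in> spectrum scaleA a \<Longrightarrow> l + m \<in> spectrum scaleA (a + scaleA m 1)"
  by (simp add: spectrum_def scale_left_distrib algebra_simps)

text \<open>
  If \<open>i\<close> is in the spectrum of \<open>a\<close>, then \<open>(1 + t) i\<close> is in that of \<open>a + t i\<close>, whose norm is too
  small for large \<open>t\<close>.
\<close>

lemma not_in_spectrum_imaginary_unit:
  assumes a: "star a = a" and i: "i * i = - 1" "fcnj i = - i"
  shows "i \<notin> spectrum scaleA a"
proof
  assume "i \<in> spectrum scaleA a"
  then have le: "norm (i + of_real t * i) \<le> norm (a + scaleA (of_real t * i) 1)" for t
    by (intro norm_le_of_spectrum spectrum_shift)
  have "(1 + t)\<^sup>2 \<le> (norm a)\<^sup>2 + t\<^sup>2" if t: "0 \<le> t" for t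
  proof -
    let ?b = "a + scaleA (of_real t * i) 1"
    have "i + of_real t * i = of_real 0 + of_real (1 + t) * i" by (simp add: algebra_simps)
    then have "1 + t \<le> norm ?b" using le[of t] norm_complex_unit[OF i, of 0 "1 + t"] t by simp
    then have "(1 + t)\<^sup>2 \<le> (norm ?b)\<^sup>2" using t by (intro power_mono) auto
    also have "\<dots> = norm (star ?b * ?b)" by (simp add: cstar_identity)
    also have "star ?b = a - scaleA (of_real t * i) 1"
      by (simp add: star_add star_scaleA star_one a fcnj_mult fcnj_of_real i)
    also have "\<dots> * ?b = a * a - scaleA ((of_real t * i) * (of_real t * i)) 1"
      by (simp add: ring_distribs scaleA_one_mult scale_right_diff_distrib)
    also have "(of_real t * i) * (of_real t * i) = of_real (t * t) * (i * i)" by simp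
    also have "\<dots> = of_real (- (t * t))" unfolding i by simp
    also have "norm (a * a - scaleA (of_real (- (t * t))) 1) \<le> norm (a * a) + \<bar>t * t\<bar>"
      unfolding scaleA_of_real using norm_triangle_ineq4[of "a * a" "(- (t * t)) *\<^sub>R (1::'a)"] by simp
    finally show ?thesis using norm_self_adjoint_square[OF a] by (simp add: power2_eq_square)
  qed
  \<comment> \<open>The estimate amounts to \<open>1 + 2 t <= (norm a)\<^sup>2\<close>, which this
    \<open>t\<close> violates.\<close>
  from this[of "(norm a)\<^sup>2"] have "1 + (norm a)\<^sup>2 \<le> 0" by (simp add: power2_eq_square algebra_simps)
  then show False using zero_le_power2[of "norm a"] by linarith
qed

lemma spectrum_self_adjoint_Reals:
  assumes a: "star a = a"
  shows "spectrum scaleA a \<subseteq> \<real>"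
proof (cases rule: complex_unit_cases[where 'f = 'f])
  case (complex i)
  show ?thesis
  proof
    fix z assume z: "z \<in> spectrum scaleA a"
    obtain s t where st: "z = of_real s + of_real t * i" using complex(3) by blast
    show "z \<in> \<real>"
    proof (cases "t = 0")
      case False
      \<comment> \<open>This affine change would move a spectral value \<open>s + t i\<close> of
        \<open>a\<close> to the excluded value \<open>i\<close> of \<open>b\<close>.\<close>
      define b where "b = (1 / t) *\<^sub>R (a - s *\<^sub>R 1)"
      have "star b = b" by (simp add: b_def star_simps a)
      then have "invertible_elem (scaleA i 1 - b)"
        using not_in_spectrum_imaginary_unit[of b i] complex by (simp add: spectrum_def)
      then have "invertible_elem (t *\<^sub>R (scaleA i 1 - b))" using False by (rule invertible_elem_scaleR)
      also have "t *\<^sub>R (scaleA i 1 - b) = scaleA z 1 - a"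
        using False unfolding st scale_left_distrib scale_scale[symmetric] scaleA_of_real
        by (simp add: b_def algebra_simps)
      finally show ?thesis using z by (simp add: spectrum_def)
    qed (simp add: st)
  qed
qed simp

text \<open>With a unit \<open>i\<close>, the element is \<open>- (i - a) (i + a)\<close>, and
  \<open>i\<close> is no spectral value of \<open>a\<close> or \<open>- a\<close>. Over the reals
  the axiom \<open>real_cstar\<close> provides the inverse.\<close>

lemma invertible_one_plus_square:
  assumes a: "star a = a"
  shows "invertible_elem (1 + a * a)"
proof (cases rule: complex_unit_cases[where 'f = 'f])
  case real
  then show ?thesis using real_cstar[of a] a by simp
next
  case (complex i)
  have "invertible_elem (scaleA i 1 - a)" "invertible_elem (scaleA i 1 - (- a))"
    using not_in_spectrum_imaginary_unit[of a i] not_in_spectrum_imaginary_unit[of "- a" i] a complex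
    by (simp_all add: spectrum_def star_minus)
  then have "invertible_elem ((-1) *\<^sub>R ((scaleA i 1 - a) * (scaleA i 1 - (- a))))"
    by (intro invertible_elem_scaleR invertible_elem_mult) auto
  also have "(-1) *\<^sub>R ((scaleA i 1 - a) * (scaleA i 1 - (- a))) = 1 + a * a"
    by (simp add: ring_distribs scaleA_one_mult scale_right_diff_distrib complex)
  finally show ?thesis .
qed

text \<open>Normalise to \<open>norm x = 1\<close>; the C*-identity keeps the norm of every
  \<open>x ^ 2 ^ k\<close> equal to \<open>1\<close>. If \<open>1\<close> and \<open>- 1\<close>
  were both outside the spectrum, all \<open>1 + x\<^sup>2 - 2 c x\<close> with
  \<open>\<bar>c\<bar> <= 1\<close> would be invertible, contrary to
  \<open>not_all_invertible_on_circle\<close>.\<close>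

lemma norm_in_spectrum:
  assumes a: "star a = a"
  shows "of_real (norm a) \<in> spectrum scaleA a \<or> of_real (- norm a) \<in> spectrum scaleA a"
proof (cases "a = 0")
  case True
  then show ?thesis by (simp add: spectrum_def invertible_elem_def)
next
  case False
  then have n: "norm a \<noteq> 0" by simp
  define x where "x = (1 / norm a) *\<^sub>R a"
  have x: "star x = x" by (simp add: x_def star_scaleR a)
  have ax: "a = norm a *\<^sub>R x" using n by (simp add: x_def)
  have x1: "norm x = 1" using n by (simp add: x_def)
  show ?thesis
  proof (rule ccontr)
    assume "\<not> ?thesis"
    then have "invertible_elem (norm a *\<^sub>R 1 - a)" "invertible_elem ((- norm a) *\<^sub>R 1 - a)"
      by (simp_all only: spectrum_def scaleA_of_real mem_Collect_eq de_Morgan_disj not_not)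
    then have "invertible_elem ((1 / norm a) *\<^sub>R (norm a *\<^sub>R 1 - a))"
      "invertible_elem ((- 1 / norm a) *\<^sub>R ((- norm a) *\<^sub>R 1 - a))"
      using n by (simp_all only: invertible_elem_scaleR divide_eq_0_iff neg_equal_0_iff_equal one_neq_zero simp_thms)
    then have inv1: "invertible_elem (1 - x)" "invertible_elem (1 + x)"
      using n by (simp_all add: x_def algebra_simps)
    show False
    proof (rule not_all_invertible_on_circle[OF _ _ inv1])
      show "norm (x ^ 2 ^ k) = 1" for k by (simp add: norm_self_adjoint_power x x1)
      fix c :: real assume c: "\<bar>c\<bar> \<le> 1"
      consider "c = 1" | "c = - 1" | "\<bar>c\<bar> < 1" using c by linarith
      then show "invertible_elem (1 + x * x - (2 * c) *\<^sub>R x)"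
      proof cases
        case 1
        then have "1 + x * x - (2 * c) *\<^sub>R x = (1 - x) * (1 - x)" by (simp add: algebra_simps scaleR_2)
        then show ?thesis using inv1 by (simp add: invertible_elem_mult)
      next
        case 2
        then have "1 + x * x - (2 * c) *\<^sub>R x = (1 + x) * (1 + x)" by (simp add: algebra_simps scaleR_2)
        then show ?thesis using inv1 by (simp add: invertible_elem_mult)
      next
        case 3
        \<comment> \<open>Completing the square gives \<open>(x - c)\<^sup>2 + s\<^sup>2\<close>,
          which is \<open>s\<^sup>2 (1 + ?w\<^sup>2)\<close> with \<open>?w\<close>
          self-adjoint.\<close>
        define s where "s = sqrt (1 - c\<^sup>2)"
        have c1: "c\<^sup>2 < 1" using 3 by (simp add: abs_square_less_1)
        then have s: "s\<^sup>2 = 1 - c\<^sup>2" "s \<noteq> 0" by (simp_all add: s_def)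
        let ?w = "(1 / s) *\<^sub>R (x - c *\<^sub>R 1)"
        have "invertible_elem (s\<^sup>2 *\<^sub>R (1 + ?w * ?w))"
          using s(2) by (intro invertible_elem_scaleR invertible_one_plus_square) (simp_all add: star_simps x)
        also have "s\<^sup>2 *\<^sub>R (1 + ?w * ?w) = s\<^sup>2 *\<^sub>R 1 + (x - c *\<^sub>R 1) * (x - c *\<^sub>R 1)"
          using s(2) by (simp add: scaleR_add_right power2_eq_square)
        also have "\<dots> = 1 + x * x - (c *\<^sub>R x + c *\<^sub>R x)"
          unfolding s(1) by (simp add: algebra_simps power2_eq_square)
        also have "c *\<^sub>R x + c *\<^sub>R x = (2 * c) *\<^sub>R x" by (metis mult_2 scaleR_left_distrib)
        finally show ?thesis .
      qed
    qed
  qed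
qed

section \<open>Positive elements and their norms\<close>

lemma positive_norm_minus:
  assumes a: "star a = a"
  shows "positive_elem scaleA star (norm a *\<^sub>R 1 - a)"
  unfolding positive_elem_def
proof (intro conjI subsetI)
  show sa: "star (norm a *\<^sub>R 1 - a) = norm a *\<^sub>R 1 - a" by (simp add: star_simps a)
  fix l assume l: "l \<in> spectrum scaleA (norm a *\<^sub>R 1 - a)"
  then obtain r where r: "l = of_real r" using spectrum_self_adjoint_Reals[OF sa] by (auto elim: Reals_cases)
  then have "of_real (norm a - r) \<in> spectrum scaleA a" using l spectrum_real_shift by blast
  then have "norm (of_real (norm a - r) :: 'f) \<le> norm a" by (rule norm_le_of_spectrum)
  then have "0 \<le> r" by (simp only: norm_of_real)
  then show "l \<in> \<real>\<^sub>\<ge>\<^sub>0" using r by simp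
qed

text \<open>Let \<open>b = norm a - a\<close>. One of \<open>norm b\<close>, \<open>- norm b\<close>
  is a spectral value of \<open>b\<close>, so \<open>norm a - norm b\<close> or
  \<open>norm a + norm b\<close> is one of \<open>a\<close>. The spectrum of \<open>a\<close> lies
  between \<open>0\<close> and \<open>norm a\<close>, which bounds \<open>norm b\<close> in both
  cases.\<close>

lemma norm_minus_positive_le:
  assumes a: "positive_elem scaleA star a"
  shows "norm (norm a *\<^sub>R 1 - a) \<le> norm a"
proof -
  let ?b = "norm a *\<^sub>R 1 - a"
  have sa: "star a = a" and pos: "\<And>r. of_real r \<in> spectrum scaleA a \<Longrightarrow> 0 \<le> r"
    using a nonneg_Reals_of_realD by (auto simp: positive_elem_def)
  have bnd: "r \<le> norm a" if "of_real r \<in> spectrum scaleA a" for r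
    using norm_le_of_spectrum[OF that] by (simp only: norm_of_real)
  have "star ?b = ?b" by (simp add: star_simps sa)
  from norm_in_spectrum[OF this]
  have "of_real (norm a - norm ?b) \<in> spectrum scaleA a \<or> of_real (norm a - (- norm ?b)) \<in> spectrum scaleA a"
    by (simp only: spectrum_real_shift)
  then show ?thesis
  proof
    assume "of_real (norm a - norm ?b) \<in> spectrum scaleA a"
    from pos[OF this] show ?thesis by simp
  next
    assume "of_real (norm a - (- norm ?b)) \<in> spectrum scaleA a"
    from bnd[OF this] show ?thesis by simp
  qed
qed

text \<open>Positivity excludes \<open>- norm a\<close> unless \<open>a = 0\<close>, so
  \<open>norm a\<close> is a spectral value of \<open>a\<close> and \<open>1 + norm a\<close> one of
  \<open>1 + a\<close>.\<close>

lemma norm_one_plus_positive: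
  assumes a: "positive_elem scaleA star a"
  shows "1 + norm a \<le> norm (1 + a)"
proof -
  have sa: "star a = a" and pos: "\<And>r. of_real r \<in> spectrum scaleA a \<Longrightarrow> 0 \<le> r"
    using a nonneg_Reals_of_realD by (auto simp: positive_elem_def)
  have "of_real (norm a) \<in> spectrum scaleA a"
    using norm_in_spectrum[OF sa] pos[of "- norm a"] by (cases "a = 0") auto
  then have "of_real (norm a) + of_real 1 \<in> spectrum scaleA (a + scaleA (of_real 1) 1)"
    by (rule spectrum_shift)
  then have "norm (of_real (norm a + 1) :: 'f) \<le> norm (a + scaleA (of_real 1) 1)"
    unfolding of_real_add by (rule norm_le_of_spectrum)
  then show ?thesis unfolding norm_of_real scaleA_of_real by (simp add: add.commute)
qed

text \<open>A state is recovered from its real part by \<open>\<phi> a = f a - i * f (i * a)\<close>.\<close>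

lemma state_of_real_part:
  assumes f: "linear f" and star: "\<And>a. f (star a) = f a" and one: "f 1 = 1"
    and pos: "\<And>a. positive_elem scaleA star a \<Longrightarrow> 0 \<le> f a"
  obtains \<phi> where "state scaleA star \<phi>" "\<And>a. star a = a \<Longrightarrow> \<phi> a = of_real (f a)"
    "\<And>a. (\<And>l. f (scaleA l a) = 0) \<Longrightarrow> \<phi> a = 0"
proof (cases rule: complex_unit_cases[where 'f = 'f])
  case real
  define \<phi> where "\<phi> a = (of_real (f a) :: 'f)" for a
  have "\<phi> (scaleA l a) = l * \<phi> a" for l a
  proof -
    obtain r where "l = of_real r" using real by (metis Reals_cases UNIV_I)
    then show ?thesis by (simp add: \<phi>_def scaleA_of_real linear_scale[OF f])
  qed
  then have "Vector_Spaces.linear scaleA (*) \<phi>"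
    by (simp add: Vector_Spaces.linear_iff vector_space_axioms vector_space_over_itself.vector_space_axioms
        \<phi>_def linear_add[OF f])
  then have "state scaleA star \<phi>" using one pos star by (simp add: state_def \<phi>_def)
  moreover have "f a = 0" if "\<And>l. f (scaleA l a) = 0" for a using that[of 1] by simp
  ultimately show ?thesis using that by (simp add: \<phi>_def)
next
  case (complex i)
  define \<phi> where "\<phi> a = of_real (f a) - i * of_real (f (scaleA i a))" for a
  have ii: "i * (i * a) = - a" for a using complex(1) by (simp add: mult.assoc[symmetric])
  have "\<phi> (scaleA l a) = l * \<phi> a" for l a
  proof -
    obtain s t where st: "l = of_real s + of_real t * i" using complex(3) by blast
    have e1: "scaleA l a = s *\<^sub>R a + t *\<^sub>R scaleA i a"
      by (simp only: st scale_left_distrib scale_scale[symmetric] scaleA_of_real)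
    have e2: "scaleA i (scaleA l a) = s *\<^sub>R scaleA i a - t *\<^sub>R a"
    proof -
      have "i * l = of_real s * i + of_real (- t)"
        using complex(1) by (simp add: st algebra_simps ii)
      then show ?thesis
        by (simp only: scale_scale scale_left_distrib)
          (simp only: scale_scale[symmetric] scaleA_of_real, simp)
    qed
    have "\<phi> (scaleA l a) =
        of_real (f (s *\<^sub>R a + t *\<^sub>R scaleA i a)) - i * of_real (f (s *\<^sub>R scaleA i a - t *\<^sub>R a))"
      by (simp only: \<phi>_def e1[symmetric] e2[symmetric])
    then show ?thesis
      by (simp add: \<phi>_def linear_add[OF f] linear_diff[OF f] linear_scale[OF f] st algebra_simps ii)
  qed
  then have "Vector_Spaces.linear scaleA (*) \<phi>"
    by (simp add: Vector_Spaces.linear_iff vector_space_axioms vector_space_over_itself.vector_space_axioms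
        \<phi>_def linear_add[OF f] scale_right_distrib algebra_simps)
  moreover have sa: "\<phi> a = of_real (f a)" if "star a = a" for a
  proof -
    \<comment> \<open>\<open>star\<close> negates \<open>scaleA i a\<close> and preserves
      \<open>f\<close>, so \<open>f\<close> vanishes there and \<open>\<phi> a\<close> is
      real.\<close>
    have "f (scaleA i a) = f (star (scaleA i a))" by (simp only: star)
    also have "\<dots> = - f (scaleA i a)" using that by (simp add: star_scaleA complex linear_neg[OF f])
    finally show ?thesis by (simp add: \<phi>_def)
  qed
  moreover have "(\<real> :: 'f set) \<noteq> UNIV"
  proof
    assume "(\<real> :: 'f set) = UNIV"
    then obtain r where "i = of_real r" by (metis Reals_cases UNIV_I)
    then have "of_real (r * r) = (of_real (- 1) :: 'f)" using complex(1) by simp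
    then have "r * r = - 1" by (simp only: of_real_eq_iff)
    then show False using zero_le_square[of r] by simp
  qed
  ultimately have "state scaleA star \<phi>"
    using one pos by (simp add: state_def star_one positive_elem_def)
  moreover have "\<phi> a = 0" if "\<And>l. f (scaleA l a) = 0" for a
    using that[of 1] that[of i] by (simp add: \<phi>_def)
  ultimately show ?thesis using that sa by blast
qed

section \<open>States\<close>

text \<open>Positivity of \<open>norm a *\<^sub>R 1 - a\<close> delivers the realness of
  \<open>\<phi> a\<close> and the bound at once.\<close>

lemma state_self_adjoint:
  assumes \<phi>: "state scaleA star \<phi>" and a: "star a = a"
  obtains r where "\<phi> a = of_real r" "r \<le> norm a"
proof -
  have lin: "\<phi> (b + c) = \<phi> b + \<phi> c" "\<phi> (scaleA l b) = l * \<phi> b" for b c l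
    using \<phi> by (simp_all add: state_def Vector_Spaces.linear_iff)
  have "\<phi> (norm a *\<^sub>R 1 - a) \<in> \<real>\<^sub>\<ge>\<^sub>0"
    using \<phi> positive_norm_minus[OF a] by (simp add: state_def)
  then obtain s where s: "\<phi> (norm a *\<^sub>R 1 - a) = of_real s" "0 \<le> s" by (rule nonneg_Reals_cases)
  have "\<phi> (norm a *\<^sub>R 1) = of_real (norm a)"
    using \<phi> lin(2)[of "of_real (norm a)" 1] by (simp add: state_def scaleA_of_real)
  moreover have "\<phi> (norm a *\<^sub>R 1) = \<phi> (norm a *\<^sub>R 1 - a) + \<phi> a" by (simp add: lin(1)[symmetric])
  ultimately have "\<phi> a = of_real (norm a - s)" by (simp add: s(1) eq_diff_eq add.commute)
  then show ?thesis using s(2) by (intro that[of "norm a - s"]) auto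
qed

text \<open>A state is real on the self-adjoint elements \<open>a + star a\<close> and
  \<open>i a - i star a\<close>. As \<open>\<phi> a = 0\<close>, both \<open>\<phi> (star a)\<close>
  and \<open>- i * \<phi> (star a)\<close> are then real, which leaves only
  \<open>0\<close>.\<close>

lemma state_star_zero:
  assumes \<phi>: "state scaleA star \<phi>" and a: "\<phi> a = 0"
  shows "\<phi> (star a) = 0"
proof (cases rule: complex_unit_cases[where 'f = 'f])
  case real
  then show ?thesis using \<phi> a by (simp add: state_def)
next
  case (complex i)
  have lin: "\<phi> (b + c) = \<phi> b + \<phi> c" "\<phi> (scaleA l b) = l * \<phi> b" for b c l
    using \<phi> by (simp_all add: state_def Vector_Spaces.linear_iff)
  have "star (a + star a) = a + star a" by (simp add: star_simps add.commute)
  then obtain r where r: "\<phi> (star a) = of_real r"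
    using state_self_adjoint[OF \<phi>] by (metis lin(1) a add_0)
  have "star (scaleA i a + scaleA (- i) (star a)) = scaleA i a + scaleA (- i) (star a)"
    by (simp add: star_simps star_scaleA complex fcnj_minus add.commute)
  then obtain s where "\<phi> (scaleA i a + scaleA (- i) (star a)) = of_real s"
    by (rule state_self_adjoint[OF \<phi>])
  then have "- i * of_real r = of_real s" by (simp only: lin a r mult_zero_right add_0)
  then have "(- i * of_real r) * (- i * of_real r) = of_real (s * s)" by simp
  moreover have "(- i * of_real r) * (- i * of_real r) = (i * i) * of_real (r * r)" by simp
  ultimately have "of_real (- (r * r)) = (of_real (s * s) :: 'f)" using complex by simp
  then have "- (r * r) = s * s" by (simp only: of_real_eq_iff)
  then have "r * r \<le> 0" using zero_le_square[of s] by linarith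
  then have "r = 0" by (auto simp: mult_le_0_iff)
  then show ?thesis using r by simp
qed

text \<open>At \<open>norm a *\<^sub>R 1 - a\<close>, whose norm is at most \<open>norm a\<close>,
  the bound on \<open>f\<close> reads \<open>norm a - f a <= norm a\<close>.\<close>

lemma functional_nonneg_positive:
  fixes f :: "'a \<Rightarrow> real"
  assumes f: "linear f" "\<And>a. f a \<le> norm a" "f 1 = 1" and a: "positive_elem scaleA star a"
  shows "0 \<le> f a"
proof -
  have "f (norm a *\<^sub>R 1 - a) \<le> norm a" using f(2) norm_minus_positive_le[OF a] by (rule order_trans)
  then show ?thesis by (simp add: linear_diff[OF f(1)] linear_scale[OF f(1)] f(3))
qed

end

section \<open>Orthogonality in Hilbert modules\<close>

context hilbert_cstar_module
begin

lemma ip_add_left: "ip (x + y) z = ip x z + ip y z"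
  by (metis ip_star ip_add_right star_add)

lemma ip_add_add: "ip (x + y) (x + y) = ip x x + (ip x y + ip y x) + ip y y"
  by (simp add: ip_add_left ip_add_right)

lemma module_norm_power2: "(module_norm ip x)\<^sup>2 = norm (ip x x)"
  by (simp add: module_norm_def)

lemma module_norm_le_iff: "module_norm ip x \<le> module_norm ip y \<longleftrightarrow> norm (ip x x) \<le> norm (ip y y)"
  by (simp add: module_norm_def)

lemma bj_orthogonal_of_state:
  assumes \<phi>: "state scaleA star \<phi>" and e: "\<phi> (ip e e) = of_real (norm (ip e e))"
    and B: "\<And>b. b \<in> B \<Longrightarrow> \<phi> (ip e b) = 0"
  shows "bj_orthogonal (module_norm ip) e B"
  unfolding bj_orthogonal_def module_norm_le_iff
proof
  fix b assume b: "b \<in> B"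
  have lin: "\<phi> (b + c) = \<phi> b + \<phi> c" for b c
    using \<phi> by (simp add: state_def Vector_Spaces.linear_iff)
  have "\<phi> (ip b e) = 0"
    using state_star_zero[OF \<phi> B[OF b]] ip_star[of b e] by simp
  obtain r where r: "\<phi> (ip (e + b) (e + b)) = of_real r" "r \<le> norm (ip (e + b) (e + b))"
    using state_self_adjoint[OF \<phi> ip_star[symmetric]] by metis
  have "\<phi> (ip b b) \<in> \<real>\<^sub>\<ge>\<^sub>0" using \<phi> ip_positive by (simp add: state_def)
  then obtain s where s: "\<phi> (ip b b) = of_real s" "0 \<le> s" by (rule nonneg_Reals_cases)
  have "of_real r = (of_real (norm (ip e e) + s) :: 'f)"
    using r(1) unfolding ip_add_add lin by (simp add: e s(1) B[OF b] \<open>\<phi> (ip b e) = 0\<close>)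
  then have "r = norm (ip e e) + s" by (simp only: of_real_eq_iff)
  then show "norm (ip e e) \<le> norm (ip (e + b) (e + b))" using r(2) s(2) by simp
qed

lemma scaleE_real_ip:
  "ip e (scaleE (of_real t) b) = t *\<^sub>R ip e b" "ip (scaleE (of_real t) b) e = t *\<^sub>R ip b e"
proof -
  show *: "ip e (scaleE (of_real t) b) = t *\<^sub>R ip e b" for e b
    by (simp add: ip_scaleE_right scaleA_of_real)
  show "ip (scaleE (of_real t) b) e = t *\<^sub>R ip b e"
    using ip_star[of "scaleE (of_real t) b" e] ip_star[of b e] * by (simp add: star_scaleR)
qed

text \<open>
  Perturbing \<open>e\<close> by a small multiple \<open>t b\<close> makes the quadratic term \<open>t\<^sup>2 \<langle>b, b\<rangle>\<close> negligible;
  convexity of the norm turns the resulting first-order estimate into one at \<open>t = 1\<close>.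
\<close>

lemma bj_orthogonal_first_order:
  assumes orth: "bj_orthogonal (module_norm ip) e B" and B: "module.subspace scaleE B" and b: "b \<in> B"
  shows "1 + norm (ip e e) \<le> norm ((1 + ip e e) + (ip e b + ip b e))"
proof -
  let ?w = "1 + ip e e" and ?h = "ip e b + ip b e" and ?D = "1 + norm (ip e e)"
  have est: "?D - t * norm (ip b b) \<le> norm (?w + ?h)" if t: "0 < t" "t \<le> 1" for t
  proof -
    let ?y = "scaleE (of_real t) b"
    have "?y \<in> B" using E.subspace_scale[OF B b] .
    then have "norm (ip e e) \<le> norm (ip (e + ?y) (e + ?y))"
      using orth unfolding bj_orthogonal_def module_norm_le_iff by blast
    then have "?D \<le> norm (1 + ip (e + ?y) (e + ?y))"
      using norm_one_plus_positive[OF ip_positive, of "e + ?y"] by simp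
    also have "1 + ip (e + ?y) (e + ?y) = ((1 - t) *\<^sub>R ?w + t *\<^sub>R (?w + ?h)) + (t * t) *\<^sub>R ip b b"
      unfolding ip_add_add scaleE_real_ip by (simp add: algebra_simps)
    also have "norm \<dots> \<le> ((1 - t) * norm ?w + t * norm (?w + ?h)) + (t * t) * norm (ip b b)"
      using t by (intro norm_triangle_mono) simp_all
    \<comment> \<open>Since \<open>norm ?w <= ?D\<close>, the term \<open>(1 - t) * ?D\<close> can
      be moved to the left, after which \<open>t\<close> divides both sides.\<close>
    also have "\<dots> \<le> ((1 - t) * ?D + t * norm (?w + ?h)) + (t * t) * norm (ip b b)"
      using t norm_triangle_ineq[of 1 "ip e e"] by (intro add_right_mono mult_left_mono) simp_all
    finally have "t * (?D - t * norm (ip b b)) \<le> t * norm (?w + ?h)" by (simp add: algebra_simps)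
    then show ?thesis using t by simp
  qed
  have "((\<lambda>t. ?D - t * norm (ip b b)) \<longlongrightarrow> ?D - 0 * norm (ip b b)) (at_right 0)"
    by (intro tendsto_intros)
  moreover have "eventually (\<lambda>t. ?D - t * norm (ip b b) \<le> norm (?w + ?h)) (at_right 0)"
    using est unfolding eventually_at_right_field by (intro exI[of _ 1]) auto
  ultimately have "?D - 0 * norm (ip b b) \<le> norm (?w + ?h)"
    by (rule tendsto_upperbound) simp
  then show ?thesis by simp
qed

text \<open>Prepares \<open>norming_functional\<close>. Only real scalars are available here, since
  \<open>ip\<close> is conjugate-linear on the left and a non-real scalar acts differently on the
  two summands.\<close>

lemma subspace_real_parts:
  assumes B: "module.subspace scaleE B"
  shows "real_vector.subspace ((\<lambda>b. ip e b + ip b e) ` B)"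
proof (rule real_vector.subspaceI)
  have "ip e 0 + ip 0 e = 0" using ip_add_right[of e 0 0] ip_add_left[of 0 0 e] by simp
  then show "0 \<in> (\<lambda>b. ip e b + ip b e) ` B" using E.subspace_0[OF B] by force
next
  fix x y assume "x \<in> (\<lambda>b. ip e b + ip b e) ` B" "y \<in> (\<lambda>b. ip e b + ip b e) ` B"
  then obtain b c where bc: "b \<in> B" "c \<in> B" "x = ip e b + ip b e" "y = ip e c + ip c e" by blast
  have "x + y = ip e (b + c) + ip (b + c) e" by (simp add: bc ip_add_left ip_add_right)
  then show "x + y \<in> (\<lambda>b. ip e b + ip b e) ` B" using E.subspace_add[OF B bc(1,2)] by blast
next
  fix r x assume "x \<in> (\<lambda>b. ip e b + ip b e) ` B"
  then obtain b where b: "b \<in> B" "x = ip e b + ip b e" by blast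
  have "r *\<^sub>R x = ip e (scaleE (of_real r) b) + ip (scaleE (of_real r) b) e"
    by (simp add: b scaleE_real_ip scaleR_add_right)
  then show "r *\<^sub>R x \<in> (\<lambda>b. ip e b + ip b e) ` B" using E.subspace_scale[OF B b(1)] by blast
qed

lemma state_of_bj_orthogonal:
  assumes orth: "bj_orthogonal (module_norm ip) e B" and B: "module.subspace scaleE B"
  obtains \<phi> where "state scaleA star \<phi>" "\<phi> (ip e e) = of_real (norm (ip e e))"
    "\<And>b. b \<in> B \<Longrightarrow> \<phi> (ip e b) = 0"
proof -
  let ?H = "(\<lambda>b. ip e b + ip b e) ` B"
  obtain g where g: "linear g" "\<And>a. g a \<le> norm a" "1 + norm (ip e e) \<le> g (1 + ip e e)"
    "\<And>h. h \<in> ?H \<Longrightarrow> g h = 0"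
  proof (rule norming_functional[OF subspace_real_parts[OF B]])
    show "1 + norm (ip e e) \<le> norm ((1 + ip e e) + h)" if "h \<in> ?H" for h
      using that bj_orthogonal_first_order[OF orth B] by blast
  qed blast
  \<comment> \<open>\<open>g\<close> is at most \<open>1\<close> at \<open>1\<close> and at most
    \<open>norm (ip e e)\<close> at \<open>ip e e\<close>; the lower bound for the sum forces
    equality in both.\<close>
  have g1: "g 1 = 1" and ge: "g (ip e e) = norm (ip e e)"
    using g(2)[of 1] g(2)[of "ip e e"] g(3) linear_add[OF g(1), of 1 "ip e e"] by simp_all
  \<comment> \<open>Symmetrising keeps the values at self-adjoint elements and secures the
    invariance under \<open>star\<close> that \<open>state_of_real_part\<close> asks for.\<close>
  define f where "f a = (g a + g (star a)) / 2" for a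
  have f: "linear f"
    by (intro linearI) (simp_all add: f_def star_simps linear_add[OF g(1)] linear_scale[OF g(1)] field_simps)
  have sa: "f a = g a" if "star a = a" for a using that by (simp add: f_def)
  obtain \<phi> where \<phi>: "state scaleA star \<phi>" "\<And>a. star a = a \<Longrightarrow> \<phi> a = of_real (f a)"
    "\<And>a. (\<And>l. f (scaleA l a) = 0) \<Longrightarrow> \<phi> a = 0"
  proof (rule state_of_real_part[OF f])
    show "f (star a) = f a" for a by (simp add: f_def star_simps)
    show "f 1 = 1" by (simp add: sa star_one g1)
    show "0 \<le> f a" if "positive_elem scaleA star a" for a
      using functional_nonneg_positive[OF g(1,2) g1 that] that by (simp add: sa positive_elem_def)
  qed blast
  show ?thesis
  proof
    show "state scaleA star \<phi>" by fact
    have "star (ip e e) = ip e e" using ip_star[of e e] by simp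
    then show "\<phi> (ip e e) = of_real (norm (ip e e))" by (simp add: \<phi>(2) sa ge)
    show "\<phi> (ip e b) = 0" if b: "b \<in> B" for b
    proof (rule \<phi>(3))
      fix l
      \<comment> \<open>\<open>B\<close> is closed under all scalars, so \<open>f\<close> at every
        multiple of \<open>ip e b\<close> is half the value of \<open>g\<close> at a member of
        \<open>?H\<close>, that is \<open>0\<close>.\<close>
      have lb: "scaleE l b \<in> B" using E.subspace_scale[OF B b] .
      have "f (scaleA l (ip e b)) = (g (ip e (scaleE l b)) + g (ip (scaleE l b) e)) / 2"
        using ip_star[of "scaleE l b" e] by (simp add: f_def ip_scaleE_right)
      also have "\<dots> = g (ip e (scaleE l b) + ip (scaleE l b) e) / 2" by (simp add: linear_add[OF g(1)])
      also have "\<dots> = 0" using g(4) lb by simp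
      finally show "f (scaleA l (ip e b)) = 0" .
    qed
  qed
qed

end

theorem theorem3p5:
  fixes scaleA :: "'f::real_or_complex \<Rightarrow> 'a::{real_normed_algebra_1, banach} \<Rightarrow> 'a"
    and star :: "'a \<Rightarrow> 'a"
    and scaleE :: "'f \<Rightarrow> 'e::ab_group_add \<Rightarrow> 'e"
    and act :: "'e \<Rightarrow> 'a \<Rightarrow> 'e"
    and ip :: "'e \<Rightarrow> 'e \<Rightarrow> 'a"
    and e :: 'e and B :: "'e set"
  assumes "unital_cstar_algebra scaleA star"
    and "hilbert_cstar_module scaleA star scaleE act ip"
    and "module.subspace scaleE B"
  shows "bj_orthogonal (module_norm ip) e B \<longleftrightarrow>
    (\<exists>\<phi>. state scaleA star \<phi> \<and>
         \<phi> (ip e e) = of_real ((module_norm ip e)\<^sup>2) \<and>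
         (\<forall>b\<in>B. \<phi> (ip e b) = 0))"
proof -
  interpret hilbert_cstar_module scaleA star scaleE act ip by fact
  show ?thesis
    unfolding module_norm_power2
  proof
    assume "bj_orthogonal (module_norm ip) e B"
    then show "\<exists>\<phi>. state scaleA star \<phi> \<and> \<phi> (ip e e) = of_real (norm (ip e e)) \<and> (\<forall>b\<in>B. \<phi> (ip e b) = 0)"
      by (rule state_of_bj_orthogonal[OF _ assms(3)]) auto
  next
    assume "\<exists>\<phi>. state scaleA star \<phi> \<and> \<phi> (ip e e) = of_real (norm (ip e e)) \<and> (\<forall>b\<in>B. \<phi> (ip e b) = 0)"
    then obtain \<phi> where "state scaleA star \<phi>" "\<phi> (ip e e) = of_real (norm (ip e e))"
      "\<And>b. b \<in> B \<Longrightarrow> \<phi> (ip e b) = 0"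
      by auto
    then show "bj_orthogonal (module_norm ip) e B" by (rule bj_orthogonal_of_state)
  qed
qed

end
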